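(* Let $0<\mu<1$. For every $\varepsilon>0$ there exist $K_0\in\mathbb N$ and $\delta_0>0$ such that the following holds for every integer $K\ge K_0$. Suppose that for each $N$ a probability distribution $P_N$ on the subsets of $\{1,\ldots,N\}$ of size at most $\mu N$ is given, that $K$ users draw $\mathcal U_1,\ldots,\mathcal U_K$ independently from $P_N$, and that for each realization $\mathcal U=(\mathcal U_1,\ldots,\mathcal U_K)$ a valid shuffling scheme for $\mathcal U$ with parameters $(K,N,T)$ (for some positive integer $T$) is given, with uplink load $L_u(\mathcal U)$ and downlink load $L_d(\mathcal U)$. Suppose that real numbers $\Delta\in[0,1]$, $L_u,L_d\ge0$ are such that the information loss $\Delta$ and the loads $L_u,L_d$ are achieved with high probability for large $N$, i.e. for every $\eta>0$ the probability that $$\Delta(\mathcal U)\le\Delta+\eta,\qquad L_u(\mathcal U)\le L_u+\eta,\qquad L_d(\mathcal U)\le L_d+\eta$$ all hold tends to $1$ as $N\to\infty$. If $\Delta\le\delta_0$, then $$L_u\ge\frac1\mu-1-\varepsilon\qquad\text{and}\qquad L_d\ge\frac1\mu-1-\varepsilon.$$ (That is, $L_u$ and $L_d$ are asymptotically lower bounded by $\frac1\mu-1$ when $K$ is large and $\Delta$ approaches $0$.)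
   Context: Decentralized wireless distributed computing model. There are $K$ participating users and a dataset of $N$ files indexed by $\{1,\ldots,N\}$. For each user $q\in\{1,\ldots,K\}$ and file $n$ there is an intermediate value $v_{q,n}\in\{0,1\}^T$. A dataset placement is a tuple $\mathcal U=(\mathcal U_1,\ldots,\mathcal U_K)$ of subsets of $\{1,\ldots,N\}$; user $k$ stores the files in $\mathcal U_k$ and hence knows (exactly) the values $\{v_{q,n}: q\in\{1,\ldots,K\},\ n\in\mathcal U_k\}$. The available files are $A(\mathcal U)=\bigcup_{k=1}^K\mathcal U_k$, and the information loss is $\Delta(\mathcal U)=1-|A(\mathcal U)|/N$, the fraction of files not stored by any participating user. Users compute over the available files only. A valid shuffling scheme for $\mathcal U$ with parameters $(K,N,T)$ consists of: (a) uplink encoders $\psi_k$, $k=1,\ldots,K$, producing $W_k=\psi_k(\{v_{q,n}: q\in\{1,\ldots,K\}, n\in\mathcal U_k\})\in\{0,1\}^{\ell_k}$, sent to an access point (which has no dataset access); (b) an access-point encoder $\rho$ producing $X=\rho(W_1,\ldots,W_K)\in\{0,1\}^{\ell}$, broadcast to all users; (c) for each user $k$ a decoder that, from $X$ and $\{v_{q,n}: q\in\{1,\ldots,K\},n\in\mathcal U_k\}$, recovers $(v_{k,n})_{n\in A(\mathcal U)}$, for every possible array of values $v_{q,n}\in\{0,1\}^T$. Encoders and decoders may depend on the realized placement $\mathcal U$ and may be arbitrary functions. The uplink load is $L_u=\frac{1}{NT}\sum_{k=1}^K\ell_k$ and the downlink load is $L_d=\frac{\ell}{NT}$. *)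

theory Defs
  imports "HOL-Probability.Probability" "HOL-Probability.Product_PMF"
begin

type_synonym bits = "bool list"

definition bit_strings :: "nat \<Rightarrow> bits set" where
  "bit_strings m = {w. length w = m}"

text \<open>
  Users are \<open>1, \<dots>, K\<close>, files are \<open>1, \<dots>, N\<close>; only the sets \<open>U k\<close> with \<open>k \<in> {1..K}\<close> matter.
\<close>

type_synonym placement = "nat \<Rightarrow> nat set"

definition available_files :: "nat \<Rightarrow> placement \<Rightarrow> nat set" where
  "available_files K U = (\<Union>k\<in>{1..K}. U k)"

definition information_loss :: "nat \<Rightarrow> nat \<Rightarrow> placement \<Rightarrow> real" where
  "information_loss K N U = 1 - real (card (available_files K U)) / real N"

text \<open>The entry at \<open>(q, n)\<close> is the intermediate value of file \<open>n\<close> wanted by user \<open>q\<close>.\<close>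

type_synonym value_array = "nat \<times> nat \<Rightarrow> bits"

definition value_arrays :: "nat \<Rightarrow> nat set \<Rightarrow> nat \<Rightarrow> value_array set" where
  "value_arrays K F T = ({1..K} \<times> F) \<rightarrow>\<^sub>E bit_strings T"

text \<open>
  What a user storing the files in \<open>F\<close> knows. Entries outside the domain are
  \<open>undefined\<close>, so a function of \<open>local_values K F v\<close> depends on these entries of \<open>v\<close> only.
\<close>

definition local_values :: "nat \<Rightarrow> nat set \<Rightarrow> value_array \<Rightarrow> value_array" where
  "local_values K F v = restrict v ({1..K} \<times> F)"

record shuffling_scheme =
  uplink_length :: "nat \<Rightarrow> nat"
  downlink_length :: nat
  uplink_encoder :: "nat \<Rightarrow> value_array \<Rightarrow> bits"
  access_point_encoder :: "(nat \<Rightarrow> bits) \<Rightarrow> bits"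
  user_decoder :: "nat \<Rightarrow> bits \<Rightarrow> value_array \<Rightarrow> nat \<Rightarrow> bits"

definition uplink_messages ::
  "nat \<Rightarrow> placement \<Rightarrow> shuffling_scheme \<Rightarrow> value_array \<Rightarrow> nat \<Rightarrow> bits" where
  "uplink_messages K U S v =
     (\<lambda>k\<in>{1..K}. uplink_encoder S k (local_values K (U k) v))"

definition downlink_message ::
  "nat \<Rightarrow> placement \<Rightarrow> shuffling_scheme \<Rightarrow> value_array \<Rightarrow> bits" where
  "downlink_message K U S v = access_point_encoder S (uplink_messages K U S v)"

definition valid_scheme ::
  "nat \<Rightarrow> nat \<Rightarrow> nat \<Rightarrow> placement \<Rightarrow> shuffling_scheme \<Rightarrow> bool" where
  "valid_scheme K N T U S \<longleftrightarrow>
     (\<forall>k\<in>{1..K}. uplink_encoder S k \<in> value_arrays K (U k) T \<rightarrow> bit_strings (uplink_length S k)) \<and>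
     access_point_encoder S \<in>
       (\<Pi>\<^sub>E k\<in>{1..K}. bit_strings (uplink_length S k)) \<rightarrow> bit_strings (downlink_length S) \<and>
     (\<forall>v\<in>value_arrays K {1..N} T. \<forall>k\<in>{1..K}. \<forall>n\<in>available_files K U.
        user_decoder S k (downlink_message K U S v) (local_values K (U k) v) n = v (k, n))"

definition uplink_load :: "nat \<Rightarrow> nat \<Rightarrow> nat \<Rightarrow> shuffling_scheme \<Rightarrow> real" where
  "uplink_load K N T S = (\<Sum>k=1..K. real (uplink_length S k)) / (real N * real T)"

definition downlink_load :: "nat \<Rightarrow> nat \<Rightarrow> shuffling_scheme \<Rightarrow> real" where
  "downlink_load N T S = real (downlink_length S) / (real N * real T)"

text \<open>
  The joint law of the placements of \<open>K\<close> users drawing independently from \<open>p\<close>.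
  The value \<open>{}\<close> is only the dummy used at indices outside \<open>{1..K}\<close>.
\<close>

definition iid_placement :: "nat \<Rightarrow> nat set pmf \<Rightarrow> placement pmf" where
  "iid_placement K p = Pi_pmf {1..K} {} (\<lambda>_. p)"

end

theory Submission
  imports Defs
begin

text \<open>
  Let user \<open>k\<close> decode after users \<open>1, \<dots>, k - 1\<close>. The entries \<open>(k, n)\<close> with \<open>n\<close> available but not
  stored by users \<open>1, \<dots>, k\<close> form an acyclic index coding instance: if all other entries are fixed,
  every user's side information consists of entries that earlier users have already recovered, so
  the broadcast message determines all of them. The uplink messages determine the broadcast, so
  the same count bounds both loads from below. For independent placements, the expected number of
  files missed by users \<open>1, \<dots>, k\<close> is at least \<open>N (1 - \<mu>) ^ k\<close> by convexity, and summing over \<open>k\<close>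
  gives the geometric series with limit \<open>1 / \<mu> - 1\<close>. Only a fixed number \<open>M\<close> of users enters the
  argument, so that the files lost, each counted at most \<open>M\<close> times, cost a multiple of \<open>\<Delta>\<close> that does
  not depend on \<open>K\<close>.
\<close>

section \<open>Index coding bound for a fixed placement\<close>

definition decoding_entries :: "nat \<Rightarrow> nat \<Rightarrow> placement \<Rightarrow> (nat \<times> nat) set" where
  "decoding_entries M K U = (SIGMA k:{1..M}. available_files K U - (\<Union>i\<in>{1..k}. U i))"

lemma card_bit_strings [simp]: "card (bit_strings m) = 2 ^ m"
  using card_lists_length_eq[of "UNIV :: bool set" m] by (simp add: bit_strings_def)

lemma finite_bit_strings [simp]: "finite (bit_strings m)"
  using finite_lists_length_eq[of "UNIV :: bool set" m] by (simp add: bit_strings_def)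

context
  fixes K N T M :: nat and U :: placement and S :: shuffling_scheme
  assumes valid: "valid_scheme K N T U S"
    and U_sub: "\<And>k. k \<in> {1..K} \<Longrightarrow> U k \<subseteq> {1..N}"
    and M_le: "M \<le> K"
begin

text \<open>Validity speaks of full arrays over \<open>{1..N}\<close>, so the entries outside the
  index coding instance, lost files included, are frozen at an arbitrary constant word of length
  \<open>T\<close>.\<close>

definition zero_extension :: "value_array \<Rightarrow> value_array" where
  "zero_extension w =
     (\<lambda>p\<in>{1..K} \<times> {1..N}. if p \<in> decoding_entries M K U then w p else replicate T False)"

lemma decoding_entries_subset: "decoding_entries M K U \<subseteq> {1..K} \<times> {1..N}"
  using U_sub M_le by (fastforce simp: decoding_entries_def available_files_def)

lemma finite_decoding_entries: "finite (decoding_entries M K U)"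
  using decoding_entries_subset by (rule finite_subset) simp

lemma zero_extension_in_value_arrays:
  assumes "w \<in> decoding_entries M K U \<rightarrow>\<^sub>E bit_strings T"
  shows "zero_extension w \<in> value_arrays K {1..N} T"
  using assms by (auto simp: zero_extension_def value_arrays_def bit_strings_def PiE_iff)

lemma zero_extension_eq:
  "p \<in> decoding_entries M K U \<Longrightarrow> zero_extension w p = w p"
  using decoding_entries_subset by (auto simp: zero_extension_def)

text \<open>Strong induction in decoding order: once two arrays with the same broadcast agree in all
  rows before \<open>k\<close>, user \<open>k\<close> holds the same side information for both, and
  its decoder must output the same row \<open>k\<close>.\<close>

lemma inj_on_downlink_message:
  "inj_on (\<lambda>w. downlink_message K U S (zero_extension w))
     (decoding_entries M K U \<rightarrow>\<^sub>E bit_strings T)"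
proof (rule inj_onI)
  fix w w'
  assume w: "w \<in> decoding_entries M K U \<rightarrow>\<^sub>E bit_strings T"
    and w': "w' \<in> decoding_entries M K U \<rightarrow>\<^sub>E bit_strings T"
    and same: "downlink_message K U S (zero_extension w) = downlink_message K U S (zero_extension w')"
  have eq: "w (k, n) = w' (k, n)" if "(k, n) \<in> decoding_entries M K U" for k n
    using that
  proof (induction k arbitrary: n rule: less_induct)
    case (less k)
    have k: "k \<in> {1..K}" and n: "n \<in> available_files K U" and kM: "k \<le> M"
      using less.prems M_le by (auto simp: decoding_entries_def)
    have "zero_extension w (q, m) = zero_extension w' (q, m)" if "q \<in> {1..K}" "m \<in> U k" for q m
    proof (cases "(q, m) \<in> decoding_entries M K U")
      case True
      \<comment> \<open>Row \<open>q\<close> contains no file stored by users \<open>1\<close> to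
        \<open>q\<close>, whereas \<open>m\<close> is stored by user \<open>k\<close>; hence
        \<open>k\<close> exceeds \<open>q\<close>.\<close>
      then have "q < k"
        using that k by (fastforce simp: decoding_entries_def)
      then show ?thesis
        using less.IH True by (simp add: zero_extension_eq)
    next
      case False
      then show ?thesis by (simp add: zero_extension_def)
    qed
    then have "local_values K (U k) (zero_extension w) = local_values K (U k) (zero_extension w')"
      by (auto simp: local_values_def restrict_def)
    moreover have "user_decoder S k (downlink_message K U S v) (local_values K (U k) v) n = v (k, n)"
      if "v \<in> value_arrays K {1..N} T" for v
      using valid that k n by (simp add: valid_scheme_def)
    ultimately have "zero_extension w (k, n) = zero_extension w' (k, n)"
      using same w w' zero_extension_in_value_arrays by metis
    then show ?case
      using less.prems by (simp add: zero_extension_eq)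
  qed
  show "w = w'"
  proof (rule PiE_ext[OF w w'])
    fix p assume "p \<in> decoding_entries M K U"
    then show "w p = w' p" using eq by (cases p) simp
  qed
qed

lemma card_source_arrays:
  "card (decoding_entries M K U \<rightarrow>\<^sub>E bit_strings T) = 2 ^ (T * card (decoding_entries M K U))"
  using finite_decoding_entries by (simp add: card_PiE power_mult)

lemma uplink_messages_in:
  assumes "v \<in> value_arrays K {1..N} T"
  shows "uplink_messages K U S v \<in> (\<Pi>\<^sub>E k\<in>{1..K}. bit_strings (uplink_length S k))"
proof -
  have "local_values K (U k) v \<in> value_arrays K (U k) T" if "k \<in> {1..K}" for k
    using assms U_sub[OF that] by (auto simp: local_values_def value_arrays_def PiE_iff subset_iff)
  then show ?thesis
    using valid unfolding uplink_messages_def valid_scheme_def by (intro restrict_PiE_iff[THEN iffD2]) blast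
qed

text \<open>The broadcast is \<open>access_point_encoder S\<close> applied to the uplink messages,
  so its injectivity forces that of the uplink messages. Counting them as a product of sets of bit
  strings turns the cardinality bound into a bound on the sum of lengths.\<close>

lemma uplink_length_lower_bound:
  "T * card (decoding_entries M K U) \<le> (\<Sum>k=1..K. uplink_length S k)"
proof -
  have "inj_on (access_point_encoder S \<circ> (\<lambda>w. uplink_messages K U S (zero_extension w)))
      (decoding_entries M K U \<rightarrow>\<^sub>E bit_strings T)"
    using inj_on_downlink_message by (simp add: downlink_message_def comp_def)
  then have "inj_on (\<lambda>w. uplink_messages K U S (zero_extension w))
      (decoding_entries M K U \<rightarrow>\<^sub>E bit_strings T)"
    by (rule inj_on_imageI2)
  then have "card (decoding_entries M K U \<rightarrow>\<^sub>E bit_strings T)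
      \<le> card (\<Pi>\<^sub>E k\<in>{1..K}. bit_strings (uplink_length S k))"
    by (rule card_inj_on_le)
      (use uplink_messages_in zero_extension_in_value_arrays in \<open>auto intro!: finite_PiE\<close>)
  then have "(2::nat) ^ (T * card (decoding_entries M K U)) \<le> 2 ^ (\<Sum>k=1..K. uplink_length S k)"
    by (simp add: card_source_arrays card_PiE power_sum)
  then show ?thesis by simp
qed

lemma downlink_length_lower_bound:
  "T * card (decoding_entries M K U) \<le> downlink_length S"
proof -
  have "downlink_message K U S v \<in> bit_strings (downlink_length S)"
    if "v \<in> value_arrays K {1..N} T" for v
    using valid uplink_messages_in[OF that] by (auto simp: downlink_message_def valid_scheme_def)
  then have "card (decoding_entries M K U \<rightarrow>\<^sub>E bit_strings T) \<le> card (bit_strings (downlink_length S))"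
    by (intro card_inj_on_le[OF inj_on_downlink_message])
      (use zero_extension_in_value_arrays in auto)
  then have "(2::nat) ^ (T * card (decoding_entries M K U)) \<le> 2 ^ downlink_length S"
    by (simp add: card_source_arrays)
  then show ?thesis by simp
qed

end

section \<open>Missed files and information loss\<close>

definition missed_files :: "nat \<Rightarrow> placement \<Rightarrow> nat \<Rightarrow> nat" where
  "missed_files N U k = card ({1..N} - (\<Union>i\<in>{1..k}. U i))"

text \<open>A file missed by users \<open>1\<close> to \<open>k\<close> is either available, and
  then gives a decoding entry in row \<open>k\<close>, or lost to everyone. Lost files make up the
  fraction \<open>information_loss K N U\<close> and are counted once per row, hence the factor
  \<open>M\<close>.\<close>

lemma missed_files_le_decoding_entries:
  assumes "N > 0" and "\<And>k. k \<in> {1..K} \<Longrightarrow> U k \<subseteq> {1..N}"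
  shows "(\<Sum>k=1..M. real (missed_files N U k)) / real N
    \<le> real (card (decoding_entries M K U)) / real N + real M * information_loss K N U"
proof -
  let ?A = "available_files K U"
  have A: "?A \<subseteq> {1..N}"
    using assms(2) by (force simp: available_files_def)
  then have fin: "finite ?A" by (rule finite_subset) simp
  have "real (missed_files N U k)
      \<le> real (card (?A - (\<Union>i\<in>{1..k}. U i))) + (real N - real (card ?A))" for k
  proof -
    have "missed_files N U k \<le> card ((?A - (\<Union>i\<in>{1..k}. U i)) \<union> ({1..N} - ?A))"
      unfolding missed_files_def using fin by (intro card_mono) auto
    also have "\<dots> \<le> card (?A - (\<Union>i\<in>{1..k}. U i)) + card ({1..N} - ?A)"
      by (rule card_Un_le)
    finally have "missed_files N U k + card ?A \<le> card (?A - (\<Union>i\<in>{1..k}. U i)) + N"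
      using A fin card_mono[OF _ A] by (simp add: card_Diff_subset)
    then show ?thesis by linarith
  qed
  then have "(\<Sum>k=1..M. real (missed_files N U k))
      \<le> (\<Sum>k=1..M. real (card (?A - (\<Union>i\<in>{1..k}. U i))) + (real N - real (card ?A)))"
    by (intro sum_mono)
  also have "\<dots> = real (card (decoding_entries M K U)) + real M * (real N - real (card ?A))"
    using fin by (simp add: decoding_entries_def sum.distrib)
  finally have "(\<Sum>k=1..M. real (missed_files N U k)) / real N
      \<le> (real (card (decoding_entries M K U)) + real M * (real N - real (card ?A))) / real N"
    by (rule divide_right_mono) simp
  also have "\<dots> = real (card (decoding_entries M K U)) / real N + real M * information_loss K N U"
    using assms(1) by (simp add: information_loss_def field_simps)
  finally show ?thesis .
qed

section \<open>Convexity and the expected number of missed files\<close>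

text \<open>This is the tangent of the \<open>k\<close>-th power at \<open>c\<close>. For
  \<open>k = 0\<close> the truncated exponent \<open>k - 1\<close> is harmless, because the factor
  \<open>real k\<close> vanishes.\<close>

lemma power_ge_tangent:
  fixes x c :: real
  assumes "0 \<le> x" "0 \<le> c"
  shows "c ^ k + real k * c ^ (k - 1) * (x - c) \<le> x ^ k"
proof (induction k)
  case (Suc k)
  \<comment> \<open>Expanding the outer factor \<open>x\<close> as \<open>c + (x - c)\<close>
    produces the next tangent plus a nonnegative square term, which is dropped at the end.\<close>
  have "c ^ Suc k + real (Suc k) * c ^ k * (x - c) + real k * c ^ (k - 1) * (x - c)\<^sup>2
      = x * (c ^ k + real k * c ^ (k - 1) * (x - c))"
    by (cases k) (simp_all add: algebra_simps power2_eq_square)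
  also have "\<dots> \<le> x * x ^ k"
    using Suc.IH assms(1) by (rule mult_left_mono)
  finally show ?case
    using assms(2) by (simp add: add_increasing2) (smt (verit) mult_nonneg_nonneg of_nat_0_le_iff zero_le_power zero_le_power2)
qed simp

lemma expectation_card_eq_sum_prob:
  assumes "finite B"
  shows "measure_pmf.expectation p (\<lambda>x. real (card {n \<in> B. Q n x}))
    = (\<Sum>n\<in>B. measure_pmf.prob p {x. Q n x})"
proof -
  have "real (card {n \<in> B. Q n x}) = (\<Sum>n\<in>B. indicator {x. Q n x} x)" for x
    using assms by (simp add: indicator_def sum.If_cases Int_def)
  then show ?thesis
    by (simp add: Bochner_Integration.integral_sum measure_pmf.integrable_const_bound[where B = 1])
qed

lemma integrable_measure_pmf_card:
  assumes "finite B"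
  shows "integrable (measure_pmf p) (\<lambda>x. real (card {n \<in> B. Q n x}))"
  by (rule measure_pmf.integrable_const_bound[where B = "real (card B)"])
    (use assms in \<open>auto intro!: card_mono\<close>)

lemma missed_files_eq: "missed_files N U k = card {n \<in> {1..N}. \<forall>i\<in>{1..k}. n \<notin> U i}"
  unfolding missed_files_def by (rule arg_cong[where f = card]) auto

lemma integrable_missed_files:
  "integrable (measure_pmf p) (\<lambda>U. real (missed_files N U k))"
  unfolding missed_files_eq by (rule integrable_measure_pmf_card) simp

lemma prob_missed_by_users:
  assumes "k \<le> K"
  shows "measure_pmf.prob (iid_placement K p) {U. \<forall>i\<in>{1..k}. n \<notin> U i}
    = measure_pmf.prob p {F. n \<notin> F} ^ k"
proof -
  \<comment> \<open>Users after \<open>k\<close> are unconstrained; filling in \<open>UNIV\<close>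
    for them makes the event a product over all of \<open>{1..K}\<close>, and their factors equal
    \<open>1\<close>.\<close>
  let ?B = "\<lambda>i. if i \<le> k then {F. n \<notin> F} else UNIV"
  have "{U. \<forall>i\<in>{1..k}. n \<notin> U i} = Pi {1..K} ?B"
    using assms by (auto simp: Pi_def)
  then have "measure_pmf.prob (iid_placement K p) {U. \<forall>i\<in>{1..k}. n \<notin> U i}
      = (\<Prod>i\<in>{1..K}. measure_pmf.prob p (?B i))"
    by (simp add: iid_placement_def measure_Pi_pmf_Pi)
  also have "\<dots> = (\<Prod>i\<in>{1..k}. measure_pmf.prob p {F. n \<notin> F})"
    using assms by (intro prod.mono_neutral_cong_right) auto
  finally show ?thesis by simp
qed

text \<open>By independence the expectation is the sum of \<open>?x n ^ k\<close>. The storage limit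
  only bounds the mean of the \<open>?x n\<close> from below by \<open>?c\<close>; the tangent at
  \<open>?c\<close> has nonnegative slope, so this one-sided bound suffices for the Jensen
  argument.\<close>

lemma expectation_missed_files:
  assumes "0 < \<mu>" "\<mu> < 1" "k \<le> K"
    and p: "\<And>F. F \<in> set_pmf p \<Longrightarrow> F \<subseteq> {1..N} \<and> real (card F) \<le> \<mu> * real N"
  shows "real N * (1 - \<mu>) ^ k
    \<le> measure_pmf.expectation (iid_placement K p) (\<lambda>U. real (missed_files N U k))"
proof -
  let ?x = "\<lambda>n. measure_pmf.prob p {F. n \<notin> F}" and ?c = "1 - \<mu>"
  have "real N * ?c = measure_pmf.expectation p (\<lambda>_. real N * ?c)" by simp
  also have "\<dots> \<le> measure_pmf.expectation p (\<lambda>F. real (card {n \<in> {1..N}. n \<notin> F}))"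
  proof (rule integral_mono_AE)
    have "real N * ?c \<le> real (card {n \<in> {1..N}. n \<notin> F})" if "F \<in> set_pmf p" for F
    proof -
      have "{n \<in> {1..N}. n \<notin> F} = {1..N} - F" by auto
      then show ?thesis
        using p[OF that] card_mono[of "{1..N}" F] finite_subset[of F "{1..N}"]
        by (simp add: card_Diff_subset of_nat_diff algebra_simps)
    qed
    then show "AE F in measure_pmf p. real N * ?c \<le> real (card {n \<in> {1..N}. n \<notin> F})"
      by (simp add: AE_measure_pmf_iff)
  qed (simp, rule integrable_measure_pmf_card, simp)
  also have "\<dots> = (\<Sum>n=1..N. ?x n)" by (rule expectation_card_eq_sum_prob) simp
  finally have sum: "real N * ?c \<le> (\<Sum>n=1..N. ?x n)" .
  have "0 \<le> real k * ?c ^ (k - 1) * ((\<Sum>n=1..N. ?x n) - real N * ?c)"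
    using sum assms by (intro mult_nonneg_nonneg) auto
  also have "real N * ?c ^ k + \<dots> = (\<Sum>n=1..N. ?c ^ k + real k * ?c ^ (k - 1) * (?x n - ?c))"
    by (simp add: sum.distrib sum_distrib_left[symmetric] sum_subtractf)
  also have "\<dots> \<le> (\<Sum>n=1..N. ?x n ^ k)"
    using assms by (intro sum_mono power_ge_tangent) auto
  also have "\<dots> = measure_pmf.expectation (iid_placement K p) (\<lambda>U. real (missed_files N U k))"
    unfolding missed_files_eq prob_missed_by_users[OF assms(3), symmetric]
    by (rule expectation_card_eq_sum_prob[symmetric]) simp
  finally show ?thesis by simp
qed

section \<open>From high probability to a bound on the loads\<close>

text \<open>Split according to \<open>G\<close>: the bound \<open>c\<close> applies on it, and the
  crude bound \<open>b\<close> is charged only on its complement.\<close>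

lemma expectation_le_of_prob:
  fixes f :: "'a \<Rightarrow> real"
  assumes "integrable (measure_pmf p) f" and "0 \<le> c" "0 \<le> b"
    and "\<And>x. f x \<le> b" and "\<And>x. x \<in> set_pmf p \<Longrightarrow> x \<in> G \<Longrightarrow> f x \<le> c"
  shows "measure_pmf.expectation p f \<le> c + b * (1 - measure_pmf.prob p G)"
proof -
  have "measure_pmf.expectation p f
      \<le> measure_pmf.expectation p (\<lambda>x. c + b * indicator (- G) x)"
  proof (rule integral_mono_AE[OF assms(1)])
    have "f x \<le> c + b * indicator (- G) x" if "x \<in> set_pmf p" for x
      using assms(2) assms(4)[of x] assms(5)[of x] that by (cases "x \<in> G") (auto intro: add_increasing)
    then show "AE x in measure_pmf p. f x \<le> c + b * indicator (- G) x"
      by (simp add: AE_measure_pmf_iff)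
  qed (simp add: measure_pmf.integrable_const_bound[where B = 1])
  also have "\<dots> = c + b * measure_pmf.prob p (- G)"
    by (simp add: measure_pmf.integrable_const_bound[where B = 1])
  also have "measure_pmf.prob p (- G) = 1 - measure_pmf.prob p G"
    using measure_pmf.prob_compl[of G p] by (simp add: Compl_eq_Diff_UNIV)
  finally show ?thesis .
qed

text \<open>The load \<open>L\<close> is abstract so that one argument serves both uplink and
  downlink. First \<open>N\<close> tends to infinity with \<eta> fixed, which removes the bad event;
  then \<eta> tends to \<open>0\<close>.\<close>

lemma load_lower_bound:
  fixes P :: "nat \<Rightarrow> nat set pmf" and L :: "nat \<Rightarrow> placement \<Rightarrow> real"
  assumes \<mu>: "0 < \<mu>" "\<mu> < 1" and "M \<le> K" and "0 \<le> \<Delta>" "0 \<le> l"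
    and P: "\<And>N F. N > 0 \<Longrightarrow> F \<in> set_pmf (P N) \<Longrightarrow> F \<subseteq> {1..N} \<and> real (card F) \<le> \<mu> * real N"
    and L: "\<And>N U. N > 0 \<Longrightarrow> U \<in> set_pmf (iid_placement K (P N)) \<Longrightarrow>
      real (card (decoding_entries M K U)) / real N \<le> L N U"
    and lim: "\<And>\<eta>. \<eta> > 0 \<Longrightarrow> (\<lambda>N. measure_pmf.prob (iid_placement K (P N))
      {U. information_loss K N U \<le> \<Delta> + \<eta> \<and> L N U \<le> l + \<eta>}) \<longlonglongrightarrow> 1"
  shows "(\<Sum>k=1..M. (1 - \<mu>) ^ k) \<le> l + real M * \<Delta>"
proof -
  let ?p = "\<lambda>N. iid_placement K (P N)"
  let ?G = "\<lambda>\<eta> N. {U. information_loss K N U \<le> \<Delta> + \<eta> \<and> L N U \<le> l + \<eta>}"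
  let ?f = "\<lambda>N U. (\<Sum>k=1..M. real (missed_files N U k)) / real N"
  have bound: "(\<Sum>k=1..M. (1 - \<mu>) ^ k) \<le> l + real M * \<Delta> + (1 + real M) * \<eta>" if \<eta>: "\<eta> > 0" for \<eta>
  proof -
    \<comment> \<open>On the good event, decoding entries contribute at most
      \<open>l + \<eta>\<close> and lost files at most
      \<open>real M * (\<Delta> + \<eta>)\<close>.\<close>
    let ?c = "l + \<eta> + real M * (\<Delta> + \<eta>)"
    have "(\<Sum>k=1..M. (1 - \<mu>) ^ k) \<le> ?c + real M * (1 - measure_pmf.prob (?p N) (?G \<eta> N))"
      if N: "N > 0" for N
    proof -
      have "(\<Sum>k=1..M. (1 - \<mu>) ^ k) = (\<Sum>k=1..M. real N * (1 - \<mu>) ^ k) / real N"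
        using N by (simp add: sum_distrib_left[symmetric])
      also have "\<dots> \<le> (\<Sum>k=1..M. measure_pmf.expectation (?p N) (\<lambda>U. real (missed_files N U k))) / real N"
        using \<mu> \<open>M \<le> K\<close> P[OF N]
        by (intro divide_right_mono sum_mono expectation_missed_files) auto
      also have "\<dots> = measure_pmf.expectation (?p N) (?f N)"
        by (simp add: integrable_missed_files)
      also have "\<dots> \<le> ?c + real M * (1 - measure_pmf.prob (?p N) (?G \<eta> N))"
      proof (rule expectation_le_of_prob)
        show "integrable (measure_pmf (?p N)) (?f N)"
          by (simp add: integrable_missed_files)
        show "0 \<le> ?c" using assms \<eta> by simp
        show "?f N U \<le> real M" for U
        proof -
          have "real (missed_files N U k) \<le> real N" for k
            using card_mono[of "{1..N}" "{1..N} - (\<Union>i\<in>{1..k}. U i)"]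
            by (simp add: missed_files_def)
          then have "(\<Sum>k=1..M. real (missed_files N U k)) \<le> (\<Sum>k=1..M. real N)"
            by (intro sum_mono)
          then show ?thesis using N by (simp add: divide_le_eq)
        qed
        show "?f N U \<le> ?c" if U: "U \<in> set_pmf (?p N)" and G: "U \<in> ?G \<eta> N" for U
        proof -
          have "U k \<subseteq> {1..N}" if "k \<in> {1..K}" for k
            using U that P[OF N] by (auto simp: iid_placement_def set_Pi_pmf PiE_dflt_def) 
          then have "?f N U \<le> real (card (decoding_entries M K U)) / real N
              + real M * information_loss K N U"
            by (rule missed_files_le_decoding_entries[OF N])
          also have "\<dots> \<le> ?c"
            using G L[OF N U] by (intro add_mono mult_left_mono) auto
          finally show ?thesis .
        qed
      qed simp
      finally show ?thesis .
    qed
    moreover have "(\<lambda>N. ?c + real M * (1 - measure_pmf.prob (?p N) (?G \<eta> N)))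
        \<longlonglongrightarrow> ?c + real M * (1 - 1)"
      by (intro tendsto_intros lim \<eta>)
    \<comment> \<open>The inequality is available from \<open>N = 1\<close> on, which is the
      threshold supplied as witness.\<close>
    ultimately have "(\<Sum>k=1..M. (1 - \<mu>) ^ k) \<le> ?c + real M * (1 - 1)"
      by (intro LIMSEQ_le_const) (auto intro!: exI[of _ 1])
    then show ?thesis by (simp add: algebra_simps)
  qed
  show ?thesis
  proof (rule field_le_epsilon)
    fix e :: real assume "e > 0"
    then show "(\<Sum>k=1..M. (1 - \<mu>) ^ k) \<le> l + real M * \<Delta> + e"
      using bound[of "e / (1 + real M)"] by (simp add: add_pos_nonneg)
  qed
qed

section \<open>Truncated geometric series and conclusion\<close>

text \<open>The full geometric series sums to 1/\<mu>, and omitting its term for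
  \<open>k = 0\<close> subtracts \<open>1\<close>. Positivity of \<open>M\<close> allows a later
  division by \<open>M\<close>.\<close>

lemma sum_power_approx_inverse:
  fixes \<mu> \<epsilon> :: real
  assumes "0 < \<mu>" "\<mu> < 1" "0 < \<epsilon>"
  obtains M where "M > 0" "1 / \<mu> - 1 - \<epsilon> \<le> (\<Sum>k=1..M. (1 - \<mu>) ^ k)"
proof -
  have "(\<lambda>k. (1 - \<mu>) ^ k) sums (1 / (1 - (1 - \<mu>)))"
    using assms by (intro geometric_sums) auto
  then have "(\<lambda>k. (1 - \<mu>) ^ Suc k) sums (1 / \<mu> - 1)"
    by (subst sums_Suc_iff) simp
  then have "(\<lambda>M. \<Sum>k<M. (1 - \<mu>) ^ Suc k) \<longlonglongrightarrow> 1 / \<mu> - 1"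
    by (simp add: sums_def)
  then have "\<forall>\<^sub>F M in sequentially. 1 / \<mu> - 1 - \<epsilon> < (\<Sum>k<M. (1 - \<mu>) ^ Suc k)"
    using assms(3) by (intro order_tendstoD(1)) auto
  then have "\<forall>\<^sub>F M in sequentially. M > 0 \<and> 1 / \<mu> - 1 - \<epsilon> < (\<Sum>k<M. (1 - \<mu>) ^ Suc k)"
    by (intro eventually_conj eventually_gt_at_top)
  then obtain M where "M > 0" "1 / \<mu> - 1 - \<epsilon> < (\<Sum>k<M. (1 - \<mu>) ^ Suc k)"
    using eventually_happens trivial_limit_sequentially by blast
  moreover have "(\<Sum>k<M. (1 - \<mu>) ^ Suc k) = (\<Sum>k=1..M. (1 - \<mu>) ^ k)"
    by (rule sum.reindex_bij_witness[of _ "\<lambda>k. k - 1" Suc]) auto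
  ultimately show ?thesis by (intro that) auto
qed

theorem theorem4:
  fixes \<mu> :: real
  assumes "0 < \<mu>" and "\<mu> < 1"
  shows "\<forall>\<epsilon>::real. \<epsilon> > 0 \<longrightarrow>
    (\<exists>(K0::nat) (\<delta>0::real). \<delta>0 > 0 \<and>
      (\<forall>K\<ge>K0. \<forall>(P :: nat \<Rightarrow> nat set pmf)
          (T :: nat \<Rightarrow> placement \<Rightarrow> nat) (S :: nat \<Rightarrow> placement \<Rightarrow> shuffling_scheme)
          (\<Delta>::real) (Lu::real) (Ld::real).
        (\<forall>N>0. \<forall>F\<in>set_pmf (P N). F \<subseteq> {1..N} \<and> real (card F) \<le> \<mu> * real N) \<longrightarrow>
        (\<forall>N>0. \<forall>U\<in>set_pmf (iid_placement K (P N)).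
           T N U > 0 \<and> valid_scheme K N (T N U) U (S N U)) \<longrightarrow>
        0 \<le> \<Delta> \<longrightarrow> \<Delta> \<le> 1 \<longrightarrow> 0 \<le> Lu \<longrightarrow> 0 \<le> Ld \<longrightarrow>
        (\<forall>\<eta>>0. (\<lambda>N. measure_pmf.prob (iid_placement K (P N))
            {U. information_loss K N U \<le> \<Delta> + \<eta> \<and>
                uplink_load K N (T N U) (S N U) \<le> Lu + \<eta> \<and>
                downlink_load N (T N U) (S N U) \<le> Ld + \<eta>}) \<longlonglongrightarrow> 1) \<longrightarrow>
        \<Delta> \<le> \<delta>0 \<longrightarrow>
        Lu \<ge> 1 / \<mu> - 1 - \<epsilon> \<and> Ld \<ge> 1 / \<mu> - 1 - \<epsilon>))"
proof (intro allI impI)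
  fix \<epsilon> :: real
  assume "\<epsilon> > 0"
  then obtain M where M: "M > 0" "1 / \<mu> - 1 - \<epsilon> / 2 \<le> (\<Sum>k=1..M. (1 - \<mu>) ^ k)"
    using sum_power_approx_inverse[OF assms, of "\<epsilon> / 2"] by auto
  \<comment> \<open>Half of \<epsilon> pays for truncating the series at \<open>M\<close>; this
    choice makes the lost files, weighted by \<open>M\<close>, cost at most the other half. The
    threshold \<open>K0\<close> is \<open>M\<close> itself.\<close>
  let ?\<delta> = "\<epsilon> / (2 * real M)"
  show "\<exists>(K0::nat) (\<delta>0::real). \<delta>0 > 0 \<and>
      (\<forall>K\<ge>K0. \<forall>(P :: nat \<Rightarrow> nat set pmf)
          (T :: nat \<Rightarrow> placement \<Rightarrow> nat) (S :: nat \<Rightarrow> placement \<Rightarrow> shuffling_scheme)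
          (\<Delta>::real) (Lu::real) (Ld::real).
        (\<forall>N>0. \<forall>F\<in>set_pmf (P N). F \<subseteq> {1..N} \<and> real (card F) \<le> \<mu> * real N) \<longrightarrow>
        (\<forall>N>0. \<forall>U\<in>set_pmf (iid_placement K (P N)).
           T N U > 0 \<and> valid_scheme K N (T N U) U (S N U)) \<longrightarrow>
        0 \<le> \<Delta> \<longrightarrow> \<Delta> \<le> 1 \<longrightarrow> 0 \<le> Lu \<longrightarrow> 0 \<le> Ld \<longrightarrow>
        (\<forall>\<eta>>0. (\<lambda>N. measure_pmf.prob (iid_placement K (P N))
            {U. information_loss K N U \<le> \<Delta> + \<eta> \<and>
                uplink_load K N (T N U) (S N U) \<le> Lu + \<eta> \<and>
                downlink_load N (T N U) (S N U) \<le> Ld + \<eta>}) \<longlonglongrightarrow> 1) \<longrightarrow>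
        \<Delta> \<le> \<delta>0 \<longrightarrow>
        Lu \<ge> 1 / \<mu> - 1 - \<epsilon> \<and> Ld \<ge> 1 / \<mu> - 1 - \<epsilon>)"
  proof (rule exI[of _ M], rule exI[of _ ?\<delta>], intro conjI[of "?\<delta> > 0"] allI impI)
    show "?\<delta> > 0" using \<open>\<epsilon> > 0\<close> M(1) by simp
    fix K :: nat and P :: "nat \<Rightarrow> nat set pmf" and T :: "nat \<Rightarrow> placement \<Rightarrow> nat"
      and S :: "nat \<Rightarrow> placement \<Rightarrow> shuffling_scheme" and \<Delta> Lu Ld :: real
    assume K: "M \<le> K"
      and P: "\<forall>N>0. \<forall>F\<in>set_pmf (P N). F \<subseteq> {1..N} \<and> real (card F) \<le> \<mu> * real N"
      and S: "\<forall>N>0. \<forall>U\<in>set_pmf (iid_placement K (P N)).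
           T N U > 0 \<and> valid_scheme K N (T N U) U (S N U)"
      and nonneg: "0 \<le> \<Delta>" "0 \<le> Lu" "0 \<le> Ld"
      and lim: "\<forall>\<eta>>0. (\<lambda>N. measure_pmf.prob (iid_placement K (P N))
            {U. information_loss K N U \<le> \<Delta> + \<eta> \<and>
                uplink_load K N (T N U) (S N U) \<le> Lu + \<eta> \<and>
                downlink_load N (T N U) (S N U) \<le> Ld + \<eta>}) \<longlonglongrightarrow> 1"
      and \<Delta>: "\<Delta> \<le> ?\<delta>"
    have loads: "real (card (decoding_entries M K U)) / real N \<le> uplink_load K N (T N U) (S N U)"
      "real (card (decoding_entries M K U)) / real N \<le> downlink_load N (T N U) (S N U)"
      if N: "N > 0" and U: "U \<in> set_pmf (iid_placement K (P N))" for N U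
    proof -
      have T: "T N U > 0" and valid: "valid_scheme K N (T N U) U (S N U)"
        using S N U by auto
      have sub: "U k \<subseteq> {1..N}" if "k \<in> {1..K}" for k
        using U that P N by (auto simp: iid_placement_def set_Pi_pmf PiE_dflt_def)
      have "real (card (decoding_entries M K U)) / real N \<le> real l / (real N * real (T N U))"
        if "T N U * card (decoding_entries M K U) \<le> l" for l
        using that N T of_nat_mono[OF that, where 'a = real] by (simp add: field_simps)
      from this[OF uplink_length_lower_bound[OF valid sub K]]
        this[OF downlink_length_lower_bound[OF valid sub K]]
      show "real (card (decoding_entries M K U)) / real N \<le> uplink_load K N (T N U) (S N U)"
        "real (card (decoding_entries M K U)) / real N \<le> downlink_load N (T N U) (S N U)"
        by (simp_all add: uplink_load_def downlink_load_def)
    qed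
    \<comment> \<open>Each application of \<open>load_lower_bound\<close> concerns a single load.
      Dropping the condition on the other load enlarges the event, so its probability is squeezed
      between one tending to \<open>1\<close> and \<open>1\<close>.\<close>
    have weaken: "(\<lambda>N. measure_pmf.prob (iid_placement K (P N)) (B N)) \<longlonglongrightarrow> 1"
      if "\<eta> > 0" and "\<And>N. {U. information_loss K N U \<le> \<Delta> + \<eta> \<and>
                uplink_load K N (T N U) (S N U) \<le> Lu + \<eta> \<and>
                downlink_load N (T N U) (S N U) \<le> Ld + \<eta>} \<subseteq> B N" for \<eta> B
      using that by (intro tendsto_sandwich[OF _ _ lim[rule_format, OF that(1)] tendsto_const])
        (auto intro!: always_eventually measure_pmf.finite_measure_mono)
    have "(\<Sum>k=1..M. (1 - \<mu>) ^ k) \<le> Lu + real M * \<Delta>"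
      by (rule load_lower_bound[OF assms K nonneg(1,2), where P = P and
            L = "\<lambda>N U. uplink_load K N (T N U) (S N U)"])
        (use P loads(1) in \<open>auto intro!: weaken\<close>)
    moreover have "(\<Sum>k=1..M. (1 - \<mu>) ^ k) \<le> Ld + real M * \<Delta>"
      by (rule load_lower_bound[OF assms K nonneg(1,3), where P = P and
            L = "\<lambda>N U. downlink_load N (T N U) (S N U)"])
        (use P loads(2) in \<open>auto intro!: weaken\<close>)
    moreover have "real M * \<Delta> \<le> \<epsilon> / 2"
      using \<Delta> M(1) by (simp add: field_simps)
    ultimately show "Lu \<ge> 1 / \<mu> - 1 - \<epsilon> \<and> Ld \<ge> 1 / \<mu> - 1 - \<epsilon>"
      using M(2) by auto
  qed
qed

end
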